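(* Fix $\gamma\ge0$, $W>0$, an integer $t\ge0$, and let $f:Y\to\{-1,1\}$ where $Y\subset\mathbb{R}^d$ is finite. Then $\deg_{(\gamma,W)}(f)\ge t+1$ if and only if there exists a function $\Psi:Y\to\mathbb{R}$ such that (1) $\sum_{y\in Y}|\Psi(y)|=1$, and (2) $\sum_{y\in Y}\Psi(y)f(y)-W\cdot\left|\sum_{y\in Y}\Psi(y)\chi_S(y)\right|>\gamma$ for every $S\subseteq[d]$ with $|S|\le t$.
   Context: $\chi_S(y)=\prod_{i\in S}y_i$. A real polynomial is $p(y)=\sum_{S\subseteq[d]}c_S\chi_S(y)$ with degree $\max\{|S|:c_S\ne0\}$ and weight $w(p)=\sum_S|c_S|$. $\deg_{(\gamma,W)}(f)$ is the minimum degree of a polynomial $p$ with $w(p)\le W$ and $|f(y)-p(y)|\le\gamma$ for all $y\in Y$. *)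

theory Defs
  imports "HOL-Analysis.Analysis" "HOL-Library.Extended_Nat"
begin

text \<open>
  The index set \<open>[d]\<close> is the finite type \<open>'d\<close>, so \<open>S \<subseteq> [d]\<close> is \<open>S :: 'd set\<close>.
  A (multilinear) polynomial \<open>p(y) = (\<Sum>S. c\<^sub>S \<chi>\<^sub>S(y))\<close> is represented by its coefficient
  family \<open>c :: 'd set \<Rightarrow> real\<close>.
\<close>

definition chi :: "'d::finite set \<Rightarrow> real ^ 'd \<Rightarrow> real" where
  "chi S y = (\<Prod>i\<in>S. y $ i)"

definition mpoly_eval :: "('d::finite set \<Rightarrow> real) \<Rightarrow> real ^ 'd \<Rightarrow> real" where
  "mpoly_eval c y = (\<Sum>S\<in>UNIV. c S * chi S y)"

text \<open>The inserted \<open>0\<close> only matters for the zero polynomial, which gets degree \<open>0\<close>.\<close>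

definition mpoly_degree :: "('d::finite set \<Rightarrow> real) \<Rightarrow> nat" where
  "mpoly_degree c = Max (insert 0 {card S | S. c S \<noteq> 0})"

definition mpoly_weight :: "('d::finite set \<Rightarrow> real) \<Rightarrow> real" where
  "mpoly_weight c = (\<Sum>S\<in>UNIV. \<bar>c S\<bar>)"

text \<open>
  The degree is an extended natural number: it is \<open>\<infinity>\<close> if no polynomial of weight at most \<open>W\<close>
  approximates \<open>f\<close> on \<open>Y\<close> within \<open>\<gamma>\<close>; otherwise the infimum is attained.
\<close>

definition approx_degree ::
  "real \<Rightarrow> real \<Rightarrow> (real ^ 'd::finite) set \<Rightarrow> (real ^ 'd \<Rightarrow> real) \<Rightarrow> enat" where
  "approx_degree \<gamma> W Y f =
     Inf {enat (mpoly_degree c) | c.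
            mpoly_weight c \<le> W \<and> (\<forall>y\<in>Y. \<bar>f y - mpoly_eval c y\<bar> \<le> \<gamma>)}"

end

theory Submission
  imports Defs
begin

text \<open>
  Linear programming duality. Sending \<open>\<Psi>\<close> to its correlations with \<open>f\<close> and with all the \<open>\<chi>\<^sub>S\<close> maps
  the \<open>\<ell>\<^sub>1\<close>-ball onto a convex set \<open>D\<close>; condition (2) says that the image lies in an open convex
  set \<open>G\<close>. If \<open>D\<close> and \<open>G\<close> are disjoint, the normal vector of a separating hyperplane is, after
  rescaling, the coefficient vector of an approximating polynomial. Working in the space of
  correlations makes the ambient dimension that of the coefficients, independent of \<open>Y\<close>.
\<close>

text \<open>As \<open>r\<close> grows, the constant terms become negligible and only the slopes
  count. This reads bounds on a separating normal off the unbounded directions of a set.\<close>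

lemma le_if_le_add_mult_nonneg:
  fixes a b p q :: real
  assumes "\<And>r. r \<ge> 0 \<Longrightarrow> p + r * a \<ge> q + r * b"
  shows "b \<le> a"
proof (rule ccontr)
  assume "\<not> b \<le> a"
  then have pos: "b - a > 0"
    by simp
  define r where "r = (\<bar>p - q\<bar> + 1) / (b - a)"
  have "r \<ge> 0"
    using pos by (simp add: r_def)
  then have "r * (b - a) \<le> p - q"
    using assms[of r] by (simp add: algebra_simps)
  moreover have "r * (b - a) = \<bar>p - q\<bar> + 1"
    using pos by (simp add: r_def)
  ultimately show False
    by linarith
qed

text \<open>The separation half of the duality, for an arbitrary family \<open>g\<close> and a set
  \<open>T\<close> of permitted indices; later \<open>g\<close> is \<open>chi\<close> and
  \<open>T\<close> holds the sets of size at most \<open>t\<close>.\<close>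

lemma dual_witness_exists:
  fixes g :: "'s::finite \<Rightarrow> 'y \<Rightarrow> real" and f :: "'y \<Rightarrow> real" and T :: "'s set"
  assumes "\<gamma> \<ge> 0" and W: "W > 0" and "finite Y" and "T \<noteq> {}"
    and no_approx: "\<And>c. \<lbrakk>\<And>S. S \<notin> T \<Longrightarrow> c S = 0; (\<Sum>S\<in>UNIV. \<bar>c S\<bar>) \<le> W\<rbrakk>
           \<Longrightarrow> \<exists>y\<in>Y. \<bar>f y - (\<Sum>S\<in>UNIV. c S * g S y)\<bar> > \<gamma>"
  shows "\<exists>\<Psi>. (\<Sum>y\<in>Y. \<bar>\<Psi> y\<bar>) = 1 \<and>
    (\<forall>S\<in>T. (\<Sum>y\<in>Y. \<Psi> y * f y) - W * \<bar>\<Sum>y\<in>Y. \<Psi> y * g S y\<bar> > \<gamma>)"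
proof -
  define F :: "('y \<Rightarrow> real) \<Rightarrow> real \<times> (real ^ 's)" where
    "F = (\<lambda>\<Psi>. (\<Sum>y\<in>Y. \<Psi> y * f y, \<chi> S. \<Sum>y\<in>Y. \<Psi> y * g S y))"
  \<comment> \<open>The ball replaces the unit sphere to make \<open>D\<close> convex; norm exactly
    1 is restored at the end by rescaling.\<close>
  define D where "D = F ` {\<Psi>. (\<Sum>y\<in>Y. \<bar>\<Psi> y\<bar>) \<le> 1}"
  define G :: "(real \<times> (real ^ 's)) set" where
    "G = {x. \<forall>S\<in>T. fst x - W * \<bar>snd x $ S\<bar> > \<gamma>}"
  have F_lin: "F (\<lambda>y. u * \<Psi> y + v * \<Phi> y) = u *\<^sub>R F \<Psi> + v *\<^sub>R F \<Phi>" for u v \<Psi> \<Phi>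
    by (simp add: F_def vec_eq_iff sum.distrib sum_distrib_left algebra_simps)
  have "convex D"
  proof (rule convexI)
    fix x y :: "real \<times> (real ^ 's)" and u v :: real
    assume "x \<in> D" "y \<in> D" and uv: "0 \<le> u" "0 \<le> v" "u + v = 1"
    then obtain \<Psi> \<Phi> where *: "x = F \<Psi>" "(\<Sum>y\<in>Y. \<bar>\<Psi> y\<bar>) \<le> 1"
        "y = F \<Phi>" "(\<Sum>y\<in>Y. \<bar>\<Phi> y\<bar>) \<le> 1"
      by (auto simp: D_def)
    have "(\<Sum>y\<in>Y. \<bar>u * \<Psi> y + v * \<Phi> y\<bar>) \<le> (\<Sum>y\<in>Y. u * \<bar>\<Psi> y\<bar> + v * \<bar>\<Phi> y\<bar>)"
      by (intro sum_mono) (metis abs_mult abs_of_nonneg abs_triangle_ineq uv(1,2))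
    also have "\<dots> = u * (\<Sum>y\<in>Y. \<bar>\<Psi> y\<bar>) + v * (\<Sum>y\<in>Y. \<bar>\<Phi> y\<bar>)"
      by (simp add: sum.distrib sum_distrib_left)
    also have "\<dots> \<le> 1"
      using * uv by (intro convex_bound_le) auto
    finally show "u *\<^sub>R x + v *\<^sub>R y \<in> D"
      unfolding D_def * F_lin[symmetric] by blast
  qed
  have "convex G"
  proof (rule convexI)
    fix x y :: "real \<times> (real ^ 's)" and u v :: real
    assume xy: "x \<in> G" "y \<in> G" and uv: "0 \<le> u" "0 \<le> v" "u + v = 1"
    have "\<gamma> < fst (u *\<^sub>R x + v *\<^sub>R y) - W * \<bar>snd (u *\<^sub>R x + v *\<^sub>R y) $ S\<bar>" if "S \<in> T" for S
    proof -
      \<comment> \<open>\<open>?h\<close> is concave since \<open>W > 0\<close>; it is negated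
        because \<open>convex_bound_lt\<close> bounds convex combinations from above.\<close>
      let ?h = "\<lambda>x. fst x - W * \<bar>snd x $ S\<bar>"
      have "u * - ?h x + v * - ?h y < - \<gamma>"
        using xy that uv by (intro convex_bound_lt) (auto simp: G_def)
      moreover have "\<bar>u * snd x $ S + v * snd y $ S\<bar> \<le> u * \<bar>snd x $ S\<bar> + v * \<bar>snd y $ S\<bar>"
        by (metis abs_mult abs_of_nonneg abs_triangle_ineq uv(1,2))
      then have "W * \<bar>u * snd x $ S + v * snd y $ S\<bar>
          \<le> W * (u * \<bar>snd x $ S\<bar> + v * \<bar>snd y $ S\<bar>)"
        using W by (intro mult_left_mono) auto
      ultimately show ?thesis
        by (simp add: algebra_simps)
    qed
    then show "u *\<^sub>R x + v *\<^sub>R y \<in> G"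
      by (simp add: G_def)
  qed
  have "D \<inter> G \<noteq> {}"
  proof
    assume disj: "D \<inter> G = {}"
    have "F (\<lambda>_. 0) \<in> D"
      by (auto simp: D_def)
    moreover have "(\<gamma> + 1, 0) \<in> G"
      by (simp add: G_def)
    ultimately have "D \<noteq> {}" "G \<noteq> {}"
      by blast+
    from separating_hyperplane_sets[OF \<open>convex D\<close> \<open>convex G\<close> this disj]
    obtain n :: "real \<times> (real ^ 's)" and b where n: "n \<noteq> 0"
      and nD: "\<And>x. x \<in> D \<Longrightarrow> inner n x \<le> b" and nG: "\<And>x. x \<in> G \<Longrightarrow> inner n x \<ge> b"
      by metis
    define l where "l = fst n"
    define k where "k = snd n"
    have n_eq: "inner n (a, v) = l * a + (\<Sum>S\<in>UNIV. k $ S * v $ S)" for a v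
      by (simp add: l_def k_def inner_prod_def inner_vec_def)
    \<comment> \<open>Coordinates outside \<open>T\<close> are unconstrained in \<open>G\<close>, so
      \<open>G\<close> contains a whole line in that direction. A linear functional bounded below on
      a line is constant on it.\<close>
    have k_T: "k $ S = 0" if "S \<notin> T" for S
    proof -
      have *: "b \<le> l * (\<gamma> + 1) + r * k $ S" for r
      proof -
        have "(\<gamma> + 1, axis S r) \<in> G"
          using that by (auto simp: G_def axis_def)
        then have "b \<le> inner n (\<gamma> + 1, axis S r)"
          by (rule nG)
        also have "\<dots> = l * (\<gamma> + 1) + r * k $ S"
          by (simp add: inner_prod_def inner_axis l_def k_def)
        finally show ?thesis .
      qed
      have "0 \<le> k $ S"
        by (rule le_if_le_add_mult_nonneg[of b _ "l * (\<gamma> + 1)"]) (use * in simp)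
      moreover have "0 \<le> - k $ S"
        by (rule le_if_le_add_mult_nonneg[of b _ "l * (\<gamma> + 1)"]) (use *[of "- r" for r] in simp)
      ultimately show ?thesis
        by simp
    qed
    define w where "w = (\<Sum>S\<in>UNIV. \<bar>k $ S\<bar>)"
    \<comment> \<open>The test points have all coordinates of size at most \<open>r\<close>, with
      signs opposite to \<open>k\<close>; \<open>W * r\<close> pays for the constraints and
      \<open>e\<close> keeps them strict. Letting \<open>r\<close> grow gives the weight bound
      \<open>w \<le> l * W\<close>, while \<open>r = 0\<close> with \<open>e\<close> tending to 0
      gives \<open>b \<le> l * \<gamma>\<close>.\<close>
    have key: "l * (\<gamma> + e + W * r) - r * w \<ge> b" if "e > 0" "r \<ge> 0" for e r
    proof -
      let ?v = "\<chi> S. - r * sgn (k $ S)"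
      have "\<gamma> < \<gamma> + e + W * r - W * \<bar>?v $ S\<bar>" for S
      proof -
        have "W * \<bar>?v $ S\<bar> \<le> W * r"
          using W that by (intro mult_left_mono) (auto simp: sgn_if abs_mult)
        with \<open>e > 0\<close> show ?thesis
          by linarith
      qed
      then have "(\<gamma> + e + W * r, ?v) \<in> G"
        by (simp add: G_def del: vec_lambda_beta)
      then have "b \<le> inner n (\<gamma> + e + W * r, ?v)"
        by (rule nG)
      also have "\<dots> = l * (\<gamma> + e + W * r) + (\<Sum>S\<in>UNIV. - (r * \<bar>k $ S\<bar>))"
        unfolding n_eq by (intro arg_cong2[where f = "(+)"] sum.cong) (auto simp: sgn_if)
      also have "\<dots> = l * (\<gamma> + e + W * r) - r * w"
        by (simp add: w_def sum_distrib_left sum_negf)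
      finally show ?thesis .
    qed
    have "w \<le> l * W"
      by (rule le_if_le_add_mult_nonneg[of b _ "l * (\<gamma> + 1)"])
        (use key[of 1] in \<open>simp add: algebra_simps\<close>)
    have "w \<ge> 0"
      by (simp add: w_def sum_nonneg)
    have "0 \<le> l"
      using \<open>w \<ge> 0\<close> \<open>w \<le> l * W\<close> W zero_le_mult_iff[of l W] by linarith
    \<comment> \<open>The weight bound rules out a vertical hyperplane: \<open>l = 0\<close> would
      force \<open>k = 0\<close> and hence \<open>n = 0\<close>.\<close>
    have "l \<noteq> 0"
    proof
      assume "l = 0"
      then have "w = 0"
        using \<open>w \<le> l * W\<close> \<open>w \<ge> 0\<close> by simp
      then have "k = 0"
        by (simp add: w_def sum_nonneg_eq_0_iff vec_eq_iff)
      with \<open>l = 0\<close> n show False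
        by (simp add: l_def k_def prod_eq_iff)
    qed
    with \<open>0 \<le> l\<close> have "l > 0"
      by simp
    have b_le: "b \<le> l * \<gamma>"
    proof (rule field_le_epsilon)
      fix e :: real assume "e > 0"
      then show "b \<le> l * \<gamma> + e"
        using key[of "e / l" 0] \<open>l > 0\<close> by (simp add: algebra_simps)
    qed
    \<comment> \<open>With this sign, \<open>n\<close> is \<open>l\<close> times
      \<open>(1, -c)\<close>, so pairing \<open>n\<close> with \<open>F \<Psi>\<close> gives
      \<open>l\<close> times the correlation of \<open>\<Psi>\<close> with the approximation
      error.\<close>
    define c where "c = (\<lambda>S. - k $ S / l)"
    have "(\<Sum>S\<in>UNIV. \<bar>c S\<bar>) = w / l"
      using \<open>l > 0\<close> by (simp add: c_def w_def sum_divide_distrib)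
    also have "\<dots> \<le> W"
      using \<open>l > 0\<close> \<open>w \<le> l * W\<close> by (simp add: field_simps)
    finally obtain y where "y \<in> Y" and y: "\<bar>f y - (\<Sum>S\<in>UNIV. c S * g S y)\<bar> > \<gamma>"
      using no_approx[of c] k_T by (auto simp: c_def)
    let ?e = "f y - (\<Sum>S\<in>UNIV. c S * g S y)"
    have "s * ?e \<le> \<gamma>" if "\<bar>s\<bar> = 1" for s
    proof -
      \<comment> \<open>Signed point masses lie in the unit ball and turn the bound on
        \<open>D\<close> into a bound on the error at \<open>y\<close>.\<close>
      let ?\<Psi> = "\<lambda>z. if z = y then s else 0"
      have "(\<Sum>z\<in>Y. \<bar>?\<Psi> z\<bar>) = (\<Sum>z\<in>Y. if z = y then \<bar>s\<bar> else 0)"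
        by (intro sum.cong) auto
      then have "F ?\<Psi> \<in> D"
        using \<open>y \<in> Y\<close> \<open>finite Y\<close> that by (auto simp: D_def)
      then have "inner n (F ?\<Psi>) \<le> b"
        by (rule nD)
      moreover have "F ?\<Psi> = (s * f y, \<chi> S. s * g S y)"
        using \<open>y \<in> Y\<close> \<open>finite Y\<close> by (simp add: F_def if_distrib[of "\<lambda>x. x * _"] cong: if_cong)
      ultimately have "l * (s * f y) + (\<Sum>S\<in>UNIV. k $ S * (s * g S y)) \<le> l * \<gamma>"
        using b_le by (simp add: n_eq)
      also have "l * (s * f y) + (\<Sum>S\<in>UNIV. k $ S * (s * g S y)) = l * (s * ?e)"
        using \<open>l > 0\<close> by (simp add: c_def sum_distrib_left sum_negf algebra_simps)
      finally show ?thesis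
        using \<open>l > 0\<close> by simp
    qed
    from this[of 1] this[of "-1"] y show False
      by simp
  qed
  then obtain \<Psi> where "(\<Sum>y\<in>Y. \<bar>\<Psi> y\<bar>) \<le> 1" "F \<Psi> \<in> G"
    by (auto simp: D_def)
  then have le1: "(\<Sum>y\<in>Y. \<bar>\<Psi> y\<bar>) \<le> 1"
    and gt: "\<And>S. S \<in> T \<Longrightarrow> (\<Sum>y\<in>Y. \<Psi> y * f y) - W * \<bar>\<Sum>y\<in>Y. \<Psi> y * g S y\<bar> > \<gamma>"
    by (simp_all add: G_def F_def)
  define s where "s = (\<Sum>y\<in>Y. \<bar>\<Psi> y\<bar>)"
  have "s \<noteq> 0"
  proof
    assume "s = 0"
    then have "\<forall>y\<in>Y. \<Psi> y = 0"
      using \<open>finite Y\<close> by (simp add: s_def sum_nonneg_eq_0_iff)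
    with gt \<open>T \<noteq> {}\<close> \<open>\<gamma> \<ge> 0\<close> show False
      by auto
  qed
  then have s: "0 < s" "s \<le> 1"
    using le1 sum_nonneg[of Y "\<lambda>y. \<bar>\<Psi> y\<bar>"] by (auto simp: s_def less_le)
  have "(\<Sum>y\<in>Y. \<Psi> y / s * f y) - W * \<bar>\<Sum>y\<in>Y. \<Psi> y / s * g S y\<bar> > \<gamma>" if "S \<in> T" for S
  proof -
    let ?E = "(\<Sum>y\<in>Y. \<Psi> y * f y) - W * \<bar>\<Sum>y\<in>Y. \<Psi> y * g S y\<bar>"
    have "\<gamma> < ?E"
      using gt[OF that] .
    \<comment> \<open>Dividing by \<open>s \<le> 1\<close> cannot decrease \<open>?E\<close>, which
      is positive because it exceeds \<open>\<gamma> \<ge> 0\<close>.\<close>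
    also have "?E \<le> ?E / s"
      using s \<open>\<gamma> < ?E\<close> \<open>\<gamma> \<ge> 0\<close> by (simp add: le_divide_eq mult_left_le)
    also have "\<dots> = (\<Sum>y\<in>Y. \<Psi> y / s * f y) - W * \<bar>\<Sum>y\<in>Y. \<Psi> y / s * g S y\<bar>"
      using s by (simp add: sum_divide_distrib[symmetric] diff_divide_distrib)
    finally show ?thesis .
  qed
  moreover have "(\<Sum>y\<in>Y. \<bar>\<Psi> y / s\<bar>) = 1"
    using s by (simp add: s_def sum_divide_distrib[symmetric])
  ultimately show ?thesis
    by (intro exI[of _ "\<lambda>y. \<Psi> y / s"]) simp
qed

text \<open>Weak duality: pair \<open>\<Psi>\<close> with the error of a supposed approximation.
  Norm 1 bounds the result by \<open>\<gamma>\<close>, but the polynomial absorbs at most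
  \<open>W\<close> times the largest correlation over \<open>T\<close>, which leaves more than
  \<open>\<gamma>\<close>.\<close>

lemma dual_witness_excludes_approx:
  fixes g :: "'s::finite \<Rightarrow> 'y \<Rightarrow> real" and f \<Psi> :: "'y \<Rightarrow> real" and T :: "'s set"
  assumes "T \<noteq> {}"
    and norm: "(\<Sum>y\<in>Y. \<bar>\<Psi> y\<bar>) = 1"
    and gt: "\<And>S. S \<in> T \<Longrightarrow> (\<Sum>y\<in>Y. \<Psi> y * f y) - W * \<bar>\<Sum>y\<in>Y. \<Psi> y * g S y\<bar> > \<gamma>"
    and supp: "\<And>S. S \<notin> T \<Longrightarrow> c S = 0" and weight: "(\<Sum>S\<in>UNIV. \<bar>c S\<bar>) \<le> W"
  shows "\<exists>y\<in>Y. \<bar>f y - (\<Sum>S\<in>UNIV. c S * g S y)\<bar> > \<gamma>"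
proof (rule ccontr)
  assume "\<not> ?thesis"
  then have approx: "\<bar>f y - (\<Sum>S\<in>UNIV. c S * g S y)\<bar> \<le> \<gamma>" if "y \<in> Y" for y
    using that by force
  let ?q = "\<lambda>S. \<bar>\<Sum>y\<in>Y. \<Psi> y * g S y\<bar>"
  \<comment> \<open>The maximum is attained at some \<open>S0\<close>, so the strict inequality at
    that single index suffices.\<close>
  define m where "m = Max (?q ` T)"
  have "m \<in> ?q ` T"
    unfolding m_def using \<open>T \<noteq> {}\<close> by (intro Max_in) auto
  then obtain S0 where S0: "S0 \<in> T" "m = ?q S0"
    by blast
  have q_le: "?q S \<le> m" if "S \<in> T" for S
    unfolding m_def using that by (intro Max_ge) auto
  have "(\<Sum>y\<in>Y. \<Psi> y * (\<Sum>S\<in>UNIV. c S * g S y)) = (\<Sum>S\<in>UNIV. c S * (\<Sum>y\<in>Y. \<Psi> y * g S y))"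
    by (subst (1 2) sum_distrib_left, subst sum.swap) (simp add: mult.left_commute)
  also have "\<dots> \<le> (\<Sum>S\<in>UNIV. \<bar>c S\<bar> * m)"
  proof (rule sum_mono)
    fix S
    show "c S * (\<Sum>y\<in>Y. \<Psi> y * g S y) \<le> \<bar>c S\<bar> * m"
    proof (cases "S \<in> T")
      case True
      have "c S * (\<Sum>y\<in>Y. \<Psi> y * g S y) \<le> \<bar>c S\<bar> * ?q S"
        by (metis abs_ge_self abs_mult)
      also have "\<dots> \<le> \<bar>c S\<bar> * m"
        using q_le[OF True] by (intro mult_left_mono) auto
      finally show ?thesis .
    qed (simp add: supp)
  qed
  also have "\<dots> \<le> W * m"
    using weight S0 by (simp add: sum_distrib_right[symmetric] mult_right_mono)
  also have "\<dots> < (\<Sum>y\<in>Y. \<Psi> y * f y) - \<gamma>"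
    using gt[OF S0(1)] S0(2) by simp
  finally have "\<gamma> < (\<Sum>y\<in>Y. \<Psi> y * (f y - (\<Sum>S\<in>UNIV. c S * g S y)))"
    by (simp add: right_diff_distrib sum_subtractf)
  also have "\<dots> \<le> (\<Sum>y\<in>Y. \<bar>\<Psi> y\<bar> * \<gamma>)"
  proof (rule sum_mono)
    fix y assume "y \<in> Y"
    have "\<Psi> y * (f y - (\<Sum>S\<in>UNIV. c S * g S y)) \<le> \<bar>\<Psi> y\<bar> * \<bar>f y - (\<Sum>S\<in>UNIV. c S * g S y)\<bar>"
      by (metis abs_ge_self abs_mult)
    also have "\<dots> \<le> \<bar>\<Psi> y\<bar> * \<gamma>"
      using approx[OF \<open>y \<in> Y\<close>] by (intro mult_left_mono) auto
    finally show "\<Psi> y * (f y - (\<Sum>S\<in>UNIV. c S * g S y)) \<le> \<bar>\<Psi> y\<bar> * \<gamma>" .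
  qed
  also have "\<dots> = \<gamma>"
    using norm by (simp add: sum_distrib_right[symmetric])
  finally show False
    by simp
qed

lemma mpoly_degree_le_iff: "mpoly_degree c \<le> t \<longleftrightarrow> (\<forall>S. card S > t \<longrightarrow> c S = 0)"
proof -
  have "{card S | S. c S \<noteq> 0} = card ` {S. c S \<noteq> 0}"
    by auto
  then show ?thesis
    by (auto simp: mpoly_degree_def) (meson not_le)
qed

text \<open>A lower bound on an infimum is a lower bound on every member, so the case of an empty
  set, with degree \<infinity>, is included. The right-hand side is the contrapositive.\<close>

lemma approx_degree_ge_Suc_iff:
  "approx_degree \<gamma> W Y f \<ge> enat (t + 1) \<longleftrightarrow>
    (\<forall>c. mpoly_degree c \<le> t \<longrightarrow> mpoly_weight c \<le> W \<longrightarrow>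
      (\<exists>y\<in>Y. \<bar>f y - mpoly_eval c y\<bar> > \<gamma>))"
proof -
  have "approx_degree \<gamma> W Y f \<ge> enat (t + 1) \<longleftrightarrow>
      (\<forall>c. mpoly_weight c \<le> W \<and> (\<forall>y\<in>Y. \<bar>f y - mpoly_eval c y\<bar> \<le> \<gamma>)
        \<longrightarrow> t < mpoly_degree c)"
    by (auto simp: approx_degree_def le_Inf_iff Suc_le_eq)
  then show ?thesis
    by (meson not_le)
qed

theorem theorem5p3:
  fixes \<gamma> W :: real and t :: nat
    and Y :: "(real ^ 'd::finite) set" and f :: "real ^ 'd \<Rightarrow> real"
  assumes "\<gamma> \<ge> 0" and "W > 0" and "finite Y" and "\<forall>y\<in>Y. f y \<in> {-1, 1}"
  shows "approx_degree \<gamma> W Y f \<ge> enat (t + 1) \<longleftrightarrow>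
    (\<exists>\<Psi> :: real ^ 'd \<Rightarrow> real.
       (\<Sum>y\<in>Y. \<bar>\<Psi> y\<bar>) = 1 \<and>
       (\<forall>S :: 'd set. card S \<le> t \<longrightarrow>
          (\<Sum>y\<in>Y. \<Psi> y * f y) - W * \<bar>\<Sum>y\<in>Y. \<Psi> y * chi S y\<bar> > \<gamma>))"
    (is "?L \<longleftrightarrow> ?R")
proof -
  define T :: "'d set set" where "T = {S. card S \<le> t}"
  \<comment> \<open>The constant monomial has degree 0, so \<open>T\<close> is nonempty even for
    \<open>t = 0\<close>.\<close>
  have "{} \<in> T"
    by (simp add: T_def)
  then have "T \<noteq> {}"
    by blast
  have deg: "mpoly_degree c \<le> t \<longleftrightarrow> (\<forall>S. S \<notin> T \<longrightarrow> c S = 0)" for c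
    by (simp add: mpoly_degree_le_iff T_def not_le)
  have "?L \<longleftrightarrow> (\<forall>c. (\<forall>S. S \<notin> T \<longrightarrow> c S = 0) \<longrightarrow> (\<Sum>S\<in>UNIV. \<bar>c S\<bar>) \<le> W \<longrightarrow>
      (\<exists>y\<in>Y. \<bar>f y - (\<Sum>S\<in>UNIV. c S * chi S y)\<bar> > \<gamma>))"
    by (simp only: approx_degree_ge_Suc_iff deg mpoly_weight_def mpoly_eval_def)
  also have "\<dots> \<longleftrightarrow> (\<exists>\<Psi>. (\<Sum>y\<in>Y. \<bar>\<Psi> y\<bar>) = 1 \<and>
      (\<forall>S\<in>T. (\<Sum>y\<in>Y. \<Psi> y * f y) - W * \<bar>\<Sum>y\<in>Y. \<Psi> y * chi S y\<bar> > \<gamma>))"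
    using dual_witness_exists[OF \<open>\<gamma> \<ge> 0\<close> \<open>W > 0\<close> \<open>finite Y\<close> \<open>T \<noteq> {}\<close>, of f chi]
      dual_witness_excludes_approx[OF \<open>T \<noteq> {}\<close>, where Y = Y and f = f and W = W and \<gamma> = \<gamma> and g = chi]
    by blast
  also have "\<dots> \<longleftrightarrow> ?R"
    by (simp add: T_def)
  finally show ?thesis .
qed

end
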